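(* Let $\mathfrak{X}=(\Omega,\{R_0,R_1,\ldots,R_d\})$ be a quasi-thin association scheme which is not thin and whose automorphism group $G=\operatorname{Aut}(\mathfrak{X})$ is transitive on $\Omega$. Then $\mathfrak{X}$ is triply transitive if and only if $\mathfrak{X}$ does not admit any $\mathbb{Z}_2$-diamond pair.
   Context: An association scheme $\mathfrak{X}=(\Omega,\mathcal{R})$ consists of a finite set $\Omega$ and a set $\mathcal{R}=\{R_0,\ldots,R_d\}$ of (nonempty) relations on $\Omega$ with $R_0=\{(\omega,\omega):\omega\in\Omega\}$ such that: $\mathcal{R}$ is a partition of $\Omega\times\Omega$; for every $i$ the relation $R_i^*=\{(v,u):(u,v)\in R_i\}$ is in $\mathcal{R}$; and for all $0\le i,j,k\le d$ there is an integer $p_{ij}^k\ge 0$ such that $|\{w\in\Omega:(u,w)\in R_i,\ (w,v)\in R_j\}|=p_{ij}^k$ for every $(u,v)\in R_k$. (Commutativity is not assumed.) The valency of $R_i$ is $|\{u:(v,u)\in R_i\}|$ (independent of $v$). The scheme is thin if all valencies are $1$, and quasi-thin if all valencies are in $\{1,2\}$. $\operatorname{Aut}(\mathfrak{X})$ is the group of permutations of $\Omega$ preserving every $R_i$. The scheme is Schurian if the $R_i$ are the orbitals (orbits on $\Omega\times\Omega$) of some transitive group on $\Omega$; by a known theorem of Hirasaka and Muzychuk, a quasi-thin scheme has transitive automorphism group if and only if it is Schurian. Fix $v\in\Omega$, write $H=G_v$ for the stabilizer of $v$ in $G=\operatorname{Aut}(\mathfrak{X})$, and let $\Delta_i=\{u\in\Omega:(v,u)\in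 R_i\}$, $0\le i\le d$; these are the orbits of $G_v$ on $\Omega$. Let $A_i$ be the $0/1$ adjacency matrix of $R_i$ and let $E_i^*$ be the diagonal matrix with $E_i^*(u,u)=1$ if $u\in\Delta_i$ and $0$ otherwise. Inside the matrix algebra $\operatorname{M}_\Omega(\mathbb{C})$ put: $T_0=\operatorname{Span}\{E_i^*A_jE_k^*:0\le i,j,k\le d\}$; $T$ the algebra generated by $A_0,\ldots,A_d,E_0^*,\ldots,E_d^*$ (the Terwilliger algebra); and $\tilde T=\operatorname{End}_{G_v}(\mathbb{C}^\Omega)$, the algebra of all matrices commuting with all permutation matrices of elements of $G_v$. One has $T_0\subseteq T\subseteq\tilde T$, and since $G$ is transitive these depend on $v$ only up to isomorphism. The scheme $\mathfrak{X}$ is triply transitive if $G$ is transitive and $T_0=T=\tilde T$. A pair $(i,k)$ with $0\le i,k\le d$ is a diamond pair if there exists $0\le j\le d$ with $p_{ij}^k=|\Delta_i|=|\Delta_k|=2$. Let $H_{|\Delta_i\cup\Delta_k}$ be the permutation group induced by $H=G_v$ on $\Delta_i\cup\Delta_k$. A $\mathbb{Z}_2$-diamond pair is a diamond pair $(i,k)$ with $H_{|\Delta_i\cup\Delta_k}\cong\mathbb{Z}_2$. *)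

theory Defs
  imports
    "HOL-Analysis.Analysis"
    "HOL-Algebra.Bij"
    "HOL-Algebra.Elementary_Groups"
begin

text \<open>
  The point set \<open>\<Omega>\<close> is the universe of a type of class \<open>finite\<close>, so that \<open>M\<^sub>\<Omega>(\<complex>)\<close> is
  \<^typ>\<open>complex^'a^'a\<close>. A scheme is given by \<open>d\<close> and an indexed family \<open>R\<close>, of which only the
  members \<open>R 0, \<dots>, R d\<close> matter.
\<close>

section \<open>Association schemes\<close>

definition assoc_scheme :: "nat \<Rightarrow> (nat \<Rightarrow> ('a::finite) rel) \<Rightarrow> bool" where
  "assoc_scheme d R \<longleftrightarrow>
     R 0 = Id \<and>
     inj_on R {..d} \<and> partition_on (UNIV \<times> UNIV) (R ` {..d}) \<and>
     (\<forall>i\<le>d. (R i)\<inverse> \<in> R ` {..d}) \<and>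
     (\<forall>i\<le>d. \<forall>j\<le>d. \<forall>k\<le>d. \<exists>p::nat. \<forall>(u, v)\<in>R k. card {w. (u, w) \<in> R i \<and> (w, v) \<in> R j} = p)"

definition intersection_number ::
    "(nat \<Rightarrow> ('a::finite) rel) \<Rightarrow> nat \<Rightarrow> nat \<Rightarrow> nat \<Rightarrow> nat" where
  "intersection_number R i j k =
     (THE p. \<forall>(u, v)\<in>R k. card {w. (u, w) \<in> R i \<and> (w, v) \<in> R j} = p)"

definition valency :: "('a::finite) rel \<Rightarrow> nat" where
  "valency r = (THE n. \<forall>v. card (r `` {v}) = n)"

lemma intersection_number_eq:
  assumes "assoc_scheme d R" "i \<le> d" "j \<le> d" "k \<le> d" "(u, v) \<in> R k"
  shows "intersection_number R i j k = card {w. (u, w) \<in> R i \<and> (w, v) \<in> R j}"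
proof -
  obtain p where p: "\<forall>(u, v)\<in>R k. card {w. (u, w) \<in> R i \<and> (w, v) \<in> R j} = p"
    using assms(1-4) unfolding assoc_scheme_def by meson
  have "intersection_number R i j k = p"
    unfolding intersection_number_def
    by (rule the_equality[where a = p]) (use p assms(5) in auto)
  then show ?thesis
    using p assms(5) by auto
qed

lemma valency_eq:
  assumes "assoc_scheme d R" "i \<le> d"
  shows "valency (R i) = card (R i `` {v})"
proof -
  have "R 0 = Id" and "(R i)\<inverse> \<in> R ` {..d}"
    using assms unfolding assoc_scheme_def by simp_all
  then obtain i' where i': "i' \<le> d" "R i' = (R i)\<inverse>"
    by auto
  have diag: "(u, u) \<in> R 0" for u
    using \<open>R 0 = Id\<close> by simp
  have "card (R i `` {u}) = intersection_number R i i' 0" for u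
  proof -
    have "{w. (u, w) \<in> R i \<and> (w, u) \<in> R i'} = R i `` {u}"
      using i'(2) by auto
    then show ?thesis
      using intersection_number_eq[OF assms i'(1) le0 diag, of u] by (simp only:)
  qed
  then show ?thesis
    unfolding valency_def by (simp only:) (rule the_equality, simp_all)
qed

definition thin :: "nat \<Rightarrow> (nat \<Rightarrow> ('a::finite) rel) \<Rightarrow> bool" where
  "thin d R \<longleftrightarrow> (\<forall>i\<le>d. valency (R i) = 1)"

definition quasi_thin :: "nat \<Rightarrow> (nat \<Rightarrow> ('a::finite) rel) \<Rightarrow> bool" where
  "quasi_thin d R \<longleftrightarrow> (\<forall>i\<le>d. valency (R i) \<in> {1, 2})"

section \<open>Automorphisms\<close>

definition scheme_Aut :: "nat \<Rightarrow> (nat \<Rightarrow> ('a::finite) rel) \<Rightarrow> ('a \<Rightarrow> 'a) set" where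
  "scheme_Aut d R = {g. bij g \<and> (\<forall>i\<le>d. map_prod g g ` R i = R i)}"

definition transitive_on_points :: "(('a::finite) \<Rightarrow> 'a) set \<Rightarrow> bool" where
  "transitive_on_points G \<longleftrightarrow> (\<forall>u v. \<exists>g\<in>G. g u = v)"

definition point_stabilizer :: "('a \<Rightarrow> 'a) set \<Rightarrow> 'a \<Rightarrow> ('a \<Rightarrow> 'a) set" where
  "point_stabilizer G v = {g \<in> G. g v = v}"

abbreviation suborbit :: "(nat \<Rightarrow> ('a::finite) rel) \<Rightarrow> 'a \<Rightarrow> nat \<Rightarrow> 'a set" where
  "suborbit R v i \<equiv> R i `` {v}"

text \<open>
  The permutation group induced by \<open>H\<close> on an \<open>H\<close>-invariant set \<open>S\<close>; elements of \<^const>\<open>BijGroup\<close>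
  are extensional, whence the restriction.
\<close>

definition induced_group :: "('a \<Rightarrow> 'a) set \<Rightarrow> 'a set \<Rightarrow> ('a \<Rightarrow> 'a) monoid" where
  "induced_group H S = (BijGroup S)\<lparr>carrier := (\<lambda>g. restrict g S) ` H\<rparr>"

lemma stabilizer_suborbit:
  assumes "g \<in> point_stabilizer (scheme_Aut d R) v" "i \<le> d"
  shows "g ` suborbit R v i = suborbit R v i"
proof -
  have g: "bij g" "map_prod g g ` R i = R i" "g v = v"
    using assms unfolding point_stabilizer_def scheme_Aut_def by blast+
  have sub: "g ` suborbit R v i \<subseteq> suborbit R v i"
  proof
    fix y assume "y \<in> g ` suborbit R v i"
    then obtain x where "(v, x) \<in> R i" "y = g x" by auto
    then have "map_prod g g (v, x) \<in> R i" using g(2) by blast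
    then show "y \<in> suborbit R v i" using \<open>y = g x\<close> g(3) by simp
  qed
  have "card (g ` suborbit R v i) = card (suborbit R v i)"
    using g(1) by (intro card_image inj_on_subset[OF bij_is_inj subset_UNIV])
  then show ?thesis
    by (rule card_subset_eq[OF finite sub])
qed

lemma induced_group_carrier:
  assumes "i \<le> d" "k \<le> d"
  shows "carrier (induced_group (point_stabilizer (scheme_Aut d R) v) (suborbit R v i \<union> suborbit R v k))
         \<subseteq> Bij (suborbit R v i \<union> suborbit R v k)"
proof -
  let ?S = "suborbit R v i \<union> suborbit R v k"
  have "restrict g ?S \<in> Bij ?S" if g: "g \<in> point_stabilizer (scheme_Aut d R) v" for g
  proof -
    have "inj g"
      using g by (auto simp: point_stabilizer_def scheme_Aut_def bij_def)
    moreover have "g ` ?S = ?S"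
      using stabilizer_suborbit[OF g assms(1)] stabilizer_suborbit[OF g assms(2)]
      by (simp only: image_Un)
    ultimately have "bij_betw g ?S ?S"
      unfolding bij_betw_def using inj_on_subset[OF _ subset_UNIV] by blast
    then have "bij_betw (restrict g ?S) ?S ?S"
      by (simp only: bij_betw_restrict_eq)
    then show ?thesis
      by (simp only: Bij_def Int_iff mem_Collect_eq restrict_extensional simp_thms)
  qed
  then show ?thesis
    unfolding induced_group_def by auto
qed

section \<open>The three matrix spaces\<close>

definition cmat_scale :: "complex \<Rightarrow> complex^'n^'m \<Rightarrow> complex^'n^'m" where
  "cmat_scale c M = map_matrix ((*) c) M"

text \<open>Linear spans of matrices have to be taken over \<open>\<complex>\<close>; \<^const>\<open>span\<close> is over \<open>\<real>\<close>.\<close>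

global_interpretation cmat: vector_space cmat_scale
  by standard (simp_all add: cmat_scale_def vec_eq_iff algebra_simps)

definition adj_matrix :: "('a::finite) rel \<Rightarrow> complex^'a^'a" where
  "adj_matrix r = (\<chi> x y. if (x, y) \<in> r then 1 else 0)"

definition dual_idempotent :: "('a::finite) set \<Rightarrow> complex^'a^'a" where
  "dual_idempotent S = (\<chi> x y. if x = y \<and> x \<in> S then 1 else 0)"

definition perm_matrix :: "('a::finite \<Rightarrow> 'a) \<Rightarrow> complex^'a^'a" where
  "perm_matrix g = (\<chi> x y. if x = g y then 1 else 0)"

inductive_set generated_algebra :: "(complex^'a^'a) set \<Rightarrow> (complex^('a::finite)^'a) set"
  for S :: "(complex^'a^'a) set" where
  gen: "M \<in> S \<Longrightarrow> M \<in> generated_algebra S"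
| one: "mat 1 \<in> generated_algebra S"
| add: "M \<in> generated_algebra S \<Longrightarrow> N \<in> generated_algebra S \<Longrightarrow> M + N \<in> generated_algebra S"
| scale: "M \<in> generated_algebra S \<Longrightarrow> cmat_scale c M \<in> generated_algebra S"
| mult: "M \<in> generated_algebra S \<Longrightarrow> N \<in> generated_algebra S \<Longrightarrow> M ** N \<in> generated_algebra S"

definition T0_space :: "nat \<Rightarrow> (nat \<Rightarrow> ('a::finite) rel) \<Rightarrow> 'a \<Rightarrow> (complex^'a^'a) set" where
  "T0_space d R v =
     cmat.span {dual_idempotent (suborbit R v i) ** adj_matrix (R j) ** dual_idempotent (suborbit R v k)
                | i j k. i \<le> d \<and> j \<le> d \<and> k \<le> d}"

definition terwilliger_algebra ::
    "nat \<Rightarrow> (nat \<Rightarrow> ('a::finite) rel) \<Rightarrow> 'a \<Rightarrow> (complex^'a^'a) set" where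
  "terwilliger_algebra d R v =
     generated_algebra ({adj_matrix (R i) | i. i \<le> d} \<union> {dual_idempotent (suborbit R v i) | i. i \<le> d})"

definition centralizer_algebra :: "('a::finite \<Rightarrow> 'a) set \<Rightarrow> (complex^'a^'a) set" where
  "centralizer_algebra H = {M. \<forall>g\<in>H. M ** perm_matrix g = perm_matrix g ** M}"

definition triply_transitive :: "nat \<Rightarrow> (nat \<Rightarrow> ('a::finite) rel) \<Rightarrow> 'a \<Rightarrow> bool" where
  "triply_transitive d R v \<longleftrightarrow>
     transitive_on_points (scheme_Aut d R) \<and>
     T0_space d R v = terwilliger_algebra d R v \<and>
     terwilliger_algebra d R v = centralizer_algebra (point_stabilizer (scheme_Aut d R) v)"

section \<open>Diamond pairs\<close>

definition diamond_pair ::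
    "nat \<Rightarrow> (nat \<Rightarrow> ('a::finite) rel) \<Rightarrow> 'a \<Rightarrow> nat \<Rightarrow> nat \<Rightarrow> bool" where
  "diamond_pair d R v i k \<longleftrightarrow>
     i \<le> d \<and> k \<le> d \<and>
     (\<exists>j\<le>d. intersection_number R i j k = 2 \<and>
            card (suborbit R v i) = 2 \<and> card (suborbit R v k) = 2)"

definition Z2_diamond_pair ::
    "nat \<Rightarrow> (nat \<Rightarrow> ('a::finite) rel) \<Rightarrow> 'a \<Rightarrow> nat \<Rightarrow> nat \<Rightarrow> bool" where
  "Z2_diamond_pair d R v i k \<longleftrightarrow>
     diamond_pair d R v i k \<and>
     induced_group (point_stabilizer (scheme_Aut d R) v) (suborbit R v i \<union> suborbit R v k)
       \<cong> integer_mod_group 2"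

end

theory Submission
  imports Defs
begin

text \<open>
  The permutation that fixes \<open>v\<close> and swaps the two points of
  every suborbit of size 2 is an automorphism of a quasi-thin scheme: between two suborbits of
  size 2 the relations form either a single block (a diamond pair) or two perfect matchings, and
  both patterns survive the simultaneous swap. Hence the suborbits are the orbits of \<open>H\<close>. Now
  \<open>T\<^sub>0\<close> consists of the matrices that are constant on the sets \<open>(\<Delta>\<^sub>i \<times> \<Delta>\<^sub>k) \<inter> R\<^sub>j\<close> and
  \<open>T\<close> lies between \<open>T\<^sub>0\<close> and the centralizer algebra, so triple transitivity means that every such
  set is an orbit of \<open>H\<close>. This can fail only for a diamond pair, where the induced group contains
  the simultaneous swap and is a subgroup of the Klein four-group: it is transitive on
  \<open>\<Delta>\<^sub>i \<times> \<Delta>\<^sub>k\<close> unless it has order 2.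
\<close>

section \<open>The colouring of pairs\<close>

locale scheme =
  fixes d :: nat and R :: "nat \<Rightarrow> ('a::finite) rel"
  assumes assoc: "assoc_scheme d R"
begin

text \<open>The relations partition the pairs, so the scheme is a colouring of pairs; set equations
  between relations then become equations between numbers.\<close>

definition col :: "'a \<Rightarrow> 'a \<Rightarrow> nat" where
  "col x y = (THE i. i \<le> d \<and> (x, y) \<in> R i)"

lemma col_ex1: "\<exists>!i. i \<le> d \<and> (x, y) \<in> R i"
proof -
  have P: "partition_on (UNIV \<times> UNIV) (R ` {..d})" and I: "inj_on R {..d}"
    using assoc unfolding assoc_scheme_def by auto
  have "(x, y) \<in> \<Union> (R ` {..d})"
    using partition_onD1[OF P] by auto
  moreover have "i = j" if "i \<le> d" "j \<le> d" "(x, y) \<in> R i" "(x, y) \<in> R j" for i j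
  proof -
    have "R i = R j"
      using partition_onD2[OF P] that unfolding disjoint_def by blast
    then show ?thesis
      using I that by (auto simp: inj_on_def)
  qed
  ultimately show ?thesis
    by blast
qed

lemma col_le [simp]: "col x y \<le> d" and col_in: "(x, y) \<in> R (col x y)"
  using theI'[OF col_ex1[of x y]] unfolding col_def by auto

lemma mem_R_iff: "i \<le> d \<Longrightarrow> (x, y) \<in> R i \<longleftrightarrow> col x y = i"
  using col_ex1[of x y] col_le[of x y] col_in[of x y] by blast

lemma suborbit_eq: "i \<le> d \<Longrightarrow> suborbit R v i = {w. col v w = i}"
  by (auto simp: mem_R_iff)

lemma col_self_iff: "col v x = col v v \<longleftrightarrow> x = v"
proof -
  have "R 0 = Id" using assoc unfolding assoc_scheme_def by blast
  then have "col v y = 0 \<longleftrightarrow> v = y" for y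
    using mem_R_iff[OF le0, of v y] by simp
  then show ?thesis by metis
qed

lemma col_converse:
  assumes "col x y = col x' y'"
  shows "col y x = col y' x'"
proof -
  have "(R (col x y))\<inverse> \<in> R ` {..d}"
    using assoc unfolding assoc_scheme_def by simp
  then obtain i where i: "i \<le> d" "(R (col x y))\<inverse> = R i" by auto
  then have "(y, x) \<in> R i" "(y', x') \<in> R i"
    using col_in[of x y] col_in[of x' y'] assms by auto
  then show ?thesis using i(1) by (simp add: mem_R_iff)
qed

lemma col_card:
  assumes "col x y = col x' y'" "i \<le> d" "j \<le> d"
  shows "card {w. col x w = i \<and> col w y = j} = card {w. col x' w = i \<and> col w y' = j}"
  using intersection_number_eq[OF assoc assms(2,3) col_le, OF col_in, of x y]
    intersection_number_eq[OF assoc assms(2,3) col_le, OF col_in, of x' y'] assms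
  by (simp add: mem_R_iff)

text \<open>Regularity of the scheme: \<open>w\<close> makes the intersection number for
  \<open>(v, y)\<close> positive, and \<open>(v, y')\<close> has the same one.\<close>

lemma col_transfer:
  assumes "col v y = col v y'"
  shows "\<exists>w'. col v w' = col v w \<and> col w' y' = col w y"
proof -
  have "{z. col v z = col v w \<and> col z y' = col w y} \<noteq> {}"
    using col_card[OF assms, of "col v w" "col w y"]
    by (metis (mono_tags, lifting) card_eq_0_iff col_le empty_iff finite mem_Collect_eq)
  then show ?thesis by blast
qed

section \<open>Automorphisms as colour-preserving bijections\<close>

lemma scheme_Aut_iff:
  "g \<in> scheme_Aut d R \<longleftrightarrow> bij g \<and> (\<forall>x y. col (g x) (g y) = col x y)"
proof
  assume g: "g \<in> scheme_Aut d R"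
  have "(g x, g y) \<in> R (col x y)" for x y
  proof -
    have "map_prod g g (x, y) \<in> map_prod g g ` R (col x y)"
      using col_in by blast
    then show ?thesis
      using g unfolding scheme_Aut_def by simp
  qed
  then show "bij g \<and> (\<forall>x y. col (g x) (g y) = col x y)"
    using g by (auto simp: scheme_Aut_def mem_R_iff)
next
  assume g: "bij g \<and> (\<forall>x y. col (g x) (g y) = col x y)"
  have "map_prod g g ` R i = R i" if i: "i \<le> d" for i
  proof (rule card_subset_eq)
    show "map_prod g g ` R i \<subseteq> R i"
      using g by (auto simp: mem_R_iff[OF i])
    show "card (map_prod g g ` R i) = card (R i)"
      using g by (intro card_image inj_on_subset[OF prod.inj_map subset_UNIV]) (auto simp: bij_is_inj)
  qed simp
  with g show "g \<in> scheme_Aut d R"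
    by (simp add: scheme_Aut_def)
qed

lemma stabilizer_col:
  assumes "g \<in> point_stabilizer (scheme_Aut d R) v"
  shows "bij g" "g v = v" "col (g x) (g y) = col x y" "col v (g x) = col v x"
proof -
  show *: "bij g" "g v = v" "col (g x) (g y) = col x y" for x y
    using assms by (auto simp: point_stabilizer_def scheme_Aut_iff)
  show "col v (g x) = col v x"
    using *(2) *(3)[of v x] by simp
qed

end

section \<open>The three matrix spaces\<close>

lemma matrix_mul_perm_matrix [simp]: "(M ** perm_matrix g) $ x $ y = M $ x $ g y"
  by (simp add: matrix_matrix_mult_def perm_matrix_def if_distrib cong: if_cong)

lemma perm_matrix_mul:
  assumes "inj g"
  shows "(perm_matrix g ** M) $ g x $ y = M $ x $ y"
proof -
  have "(perm_matrix g ** M) $ g x $ y = (\<Sum>z\<in>UNIV. if z = x then M $ z $ y else 0)"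
    unfolding matrix_matrix_mult_def perm_matrix_def vec_lambda_beta
    by (rule sum.cong) (use assms in \<open>auto simp: inj_eq\<close>)
  then show ?thesis by simp
qed

text \<open>Comparing both products in row \<open>g x\<close> avoids the inverse of
  \<open>g\<close>; surjectivity of \<open>g\<close> ensures that these are all rows.\<close>

lemma centralizer_algebra_iff:
  assumes "\<And>g. g \<in> H \<Longrightarrow> bij g"
  shows "M \<in> centralizer_algebra H \<longleftrightarrow> (\<forall>g\<in>H. \<forall>x y. M $ g x $ g y = M $ x $ y)"
proof -
  have "M ** perm_matrix g = perm_matrix g ** M \<longleftrightarrow> (\<forall>x y. M $ g x $ g y = M $ x $ y)"
    if "g \<in> H" for g
  proof -
    have g: "inj g" "surj g" using assms[OF that] by (auto simp: bij_def)
    have "M ** perm_matrix g = perm_matrix g ** M \<longleftrightarrow>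
        (\<forall>x y. (M ** perm_matrix g) $ g x $ y = (perm_matrix g ** M) $ g x $ y)"
      unfolding vec_eq_iff using g(2) by (metis surj_def)
    then show ?thesis by (simp add: perm_matrix_mul[OF g(1)])
  qed
  then show ?thesis by (auto simp: centralizer_algebra_def)
qed

lemma generated_algebra_subset_centralizer:
  assumes "S \<subseteq> centralizer_algebra H" "\<And>g. g \<in> H \<Longrightarrow> bij g"
  shows "generated_algebra S \<subseteq> centralizer_algebra H"
proof
  fix M assume "M \<in> generated_algebra S"
  then show "M \<in> centralizer_algebra H"
  proof induction
    case (gen M)
    then show ?case using assms(1) by blast
  next
    case one
    then show ?case by (simp add: centralizer_algebra_def)
  next
    case (add M N)
    then show ?case by (simp add: centralizer_algebra_iff[OF assms(2)])
  next
    case (scale M c)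
    then show ?case by (simp add: centralizer_algebra_iff[OF assms(2)] cmat_scale_def)
  next
    case (mult M N)
    have "(M ** N) ** perm_matrix g = perm_matrix g ** (M ** N)" if "g \<in> H" for g
    proof -
      have comm: "M ** perm_matrix g = perm_matrix g ** M" "N ** perm_matrix g = perm_matrix g ** N"
        using mult.IH that by (auto simp: centralizer_algebra_def)
      have "(M ** N) ** perm_matrix g = M ** (perm_matrix g ** N)"
        by (simp only: comm(2) matrix_mul_assoc[symmetric])
      also have "\<dots> = perm_matrix g ** (M ** N)"
        by (simp only: comm(1) matrix_mul_assoc)
      finally show ?thesis .
    qed
    then show ?case by (simp add: centralizer_algebra_def)
  qed
qed

lemma subspace_generated_algebra: "cmat.subspace (generated_algebra S)"
proof (rule cmat.subspaceI)
  show "0 \<in> generated_algebra S"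
    using generated_algebra.scale[OF generated_algebra.one, of 0] by simp
qed (auto intro: generated_algebra.intros)

lemma dual_idempotent_mult:
  "(dual_idempotent S ** M ** dual_idempotent S') $ x $ y =
     (if x \<in> S \<and> y \<in> S' then M $ x $ y else 0)"
proof -
  have r: "(N ** dual_idempotent S') $ x $ y = (if y \<in> S' then N $ x $ y else 0)" for N
  proof -
    have "(N ** dual_idempotent S') $ x $ y =
        (\<Sum>z\<in>UNIV. if z = y then if y \<in> S' then N $ x $ z else 0 else 0)"
      unfolding matrix_matrix_mult_def dual_idempotent_def vec_lambda_beta
      by (rule sum.cong) auto
    then show ?thesis by simp
  qed
  have l: "(dual_idempotent S ** N) $ x $ y = (if x \<in> S then N $ x $ y else 0)" for N
  proof -
    have "(dual_idempotent S ** N) $ x $ y =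
        (\<Sum>z\<in>UNIV. if z = x then if x \<in> S then N $ z $ y else 0 else 0)"
      unfolding matrix_matrix_mult_def dual_idempotent_def vec_lambda_beta
      by (rule sum.cong) auto
    then show ?thesis by simp
  qed
  show ?thesis by (simp add: r l)
qed

context scheme
begin

lemma T0_space_generator:
  assumes "i \<le> d" "j \<le> d" "k \<le> d"
  shows "(dual_idempotent (suborbit R v i) ** adj_matrix (R j) ** dual_idempotent (suborbit R v k))
           $ x $ y = (if (col v x, col x y, col v y) = (i, j, k) then 1 else 0)"
  using assms by (auto simp: dual_idempotent_mult adj_matrix_def mem_R_iff)

text \<open>The generators are the indicator matrices of the classes of pairs with a common colour
  triple, and such indicators span the matrices that are constant on the classes.\<close>

lemma T0_space_iff:
  "M \<in> T0_space d R v \<longleftrightarrow>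
     (\<forall>x y x' y'. col v x' = col v x \<and> col x' y' = col x y \<and> col v y' = col v y
        \<longrightarrow> M $ x' $ y' = M $ x $ y)"
    (is "_ \<longleftrightarrow> ?const M")
proof
  have "cmat.subspace {M. ?const M}"
  proof (rule cmat.subspaceI)
    fix M N :: "complex^'a^'a" and c
    assume "M \<in> {M. ?const M}" "N \<in> {M. ?const M}"
    note * = this[THEN CollectD, rule_format]
    show "M + N \<in> {M. ?const M}"
      unfolding mem_Collect_eq vector_add_component
      by (intro allI impI arg_cong2[where f = "(+)"] *)
    show "cmat_scale c M \<in> {M. ?const M}"
      unfolding mem_Collect_eq cmat_scale_def nth_map_matrix
      by (intro allI impI arg_cong2[where f = "(*)"] refl *)
  qed simp
  then have "T0_space d R v \<subseteq> {M. ?const M}"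
    unfolding T0_space_def by (intro cmat.span_minimal) (auto simp: T0_space_generator)
  then show "M \<in> T0_space d R v \<Longrightarrow> ?const M" by blast
next
  assume M: "?const M"
  define E where "E = (\<lambda>(i, j, k). dual_idempotent (suborbit R v i) ** adj_matrix (R j)
      ** dual_idempotent (suborbit R v k))"
  define t where "t x y = (col v x, col x y, col v y)" for x y
  \<comment> \<open>\<open>p q\<close> represents the class \<open>q\<close>. For a triple that does
    not occur it is arbitrary, which is harmless because \<open>E q\<close> is then zero.\<close>
  define p where "p q = (SOME z. t (fst z) (snd z) = q)" for q
  have p: "M $ fst (p (t x y)) $ snd (p (t x y)) = M $ x $ y" for x y
  proof -
    have "t (fst (p (t x y))) (snd (p (t x y))) = t x y"
      unfolding p_def by (rule someI[of _ "(x, y)"]) simp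
    then show ?thesis unfolding t_def by (intro M[rule_format]) simp
  qed
  let ?I = "{..d} \<times> {..d} \<times> {..d}"
  let ?S = "\<Sum>q\<in>?I. cmat_scale (M $ fst (p q) $ snd (p q)) (E q)"
  have E: "E q $ x $ y = (if t x y = q then 1 else 0)" if "q \<in> ?I" for q x y
    using that by (cases q) (simp add: E_def t_def T0_space_generator)
  have "?S $ x $ y = M $ x $ y" for x y
  proof -
    have "?S $ x $ y = (\<Sum>q\<in>?I. if t x y = q then M $ fst (p q) $ snd (p q) else 0)"
      unfolding sum_component
      by (rule sum.cong) (auto simp: cmat_scale_def E)
    also have "\<dots> = M $ x $ y"
      by (subst sum.delta') (auto simp: p, auto simp: t_def)
    finally show ?thesis .
  qed
  then have "M = ?S" by (simp add: vec_eq_iff)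
  moreover have "?S \<in> T0_space d R v"
    unfolding T0_space_def
    by (intro cmat.span_sum cmat.span_scale cmat.span_base) (auto simp: E_def)
  ultimately show "M \<in> T0_space d R v" by simp
qed

section \<open>The chain of inclusions between the three spaces\<close>

lemma T0_space_subset_terwilliger: "T0_space d R v \<subseteq> terwilliger_algebra d R v"
  unfolding T0_space_def terwilliger_algebra_def
proof (rule cmat.span_minimal[OF _ subspace_generated_algebra], safe)
  fix i j k assume "i \<le> d" "j \<le> d" "k \<le> d"
  then show "dual_idempotent (suborbit R v i) ** adj_matrix (R j) ** dual_idempotent (suborbit R v k)
      \<in> generated_algebra ({adj_matrix (R i) |i. i \<le> d} \<union> {dual_idempotent (suborbit R v i) |i. i \<le> d})"
    by (intro generated_algebra.mult generated_algebra.gen) blast+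
qed

lemma stabilizer_centralizer_iff:
  "M \<in> centralizer_algebra (point_stabilizer (scheme_Aut d R) v) \<longleftrightarrow>
     (\<forall>g\<in>point_stabilizer (scheme_Aut d R) v. \<forall>x y. M $ g x $ g y = M $ x $ y)"
  by (rule centralizer_algebra_iff) (rule stabilizer_col)

lemma terwilliger_subset_centralizer:
  "terwilliger_algebra d R v \<subseteq> centralizer_algebra (point_stabilizer (scheme_Aut d R) v)"
  unfolding terwilliger_algebra_def
proof (rule generated_algebra_subset_centralizer)
  show "{adj_matrix (R i) |i. i \<le> d} \<union> {dual_idempotent (suborbit R v i) |i. i \<le> d}
      \<subseteq> centralizer_algebra (point_stabilizer (scheme_Aut d R) v)"
    by (auto simp: stabilizer_centralizer_iff adj_matrix_def dual_idempotent_def mem_R_iff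
        stabilizer_col inj_eq[OF bij_is_inj[OF stabilizer_col(1)]])
qed (rule stabilizer_col)

lemma triply_transitive_iff:
  "triply_transitive d R v \<longleftrightarrow> transitive_on_points (scheme_Aut d R) \<and>
     centralizer_algebra (point_stabilizer (scheme_Aut d R) v) \<subseteq> T0_space d R v"
  using T0_space_subset_terwilliger[of v] terwilliger_subset_centralizer[of v]
  unfolding triply_transitive_def by blast

text \<open>A count of 2 exhausts a suborbit of size 2, and it is the same for every
  \<open>y\<close> in the other suborbit; so the whole block between the two carries one
  colour.\<close>

lemma diamond_pair_iff:
  "diamond_pair d R v i k \<longleftrightarrow>
     i \<le> d \<and> k \<le> d \<and> card {w. col v w = i} = 2 \<and> card {w. col v w = k} = 2 \<and>
     (\<exists>j\<le>d. \<forall>x y. col v x = i \<and> col v y = k \<longrightarrow> col x y = j)"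
proof (cases "i \<le> d \<and> k \<le> d \<and> card {w. col v w = i} = 2 \<and> card {w. col v w = k} = 2")
  case True
  then have ik: "i \<le> d" "k \<le> d" and ci: "card {w. col v w = i} = 2"
    and ck: "card {w. col v w = k} = 2" by auto
  \<comment> \<open>Without a point in this suborbit, a single-coloured block would say nothing
    about the intersection number.\<close>
  then obtain y0 where y0: "col v y0 = k" by (auto simp: card_2_iff)
  have "intersection_number R i j k = 2 \<longleftrightarrow> (\<forall>x y. col v x = i \<and> col v y = k \<longrightarrow> col x y = j)"
    if j: "j \<le> d" for j
  proof -
    have n: "intersection_number R i j k = card {w. col v w = i \<and> col w y = j}"
      if "col v y = k" for y
      using intersection_number_eq[OF assoc ik(1) j ik(2), of v y] that ik j
      by (simp add: mem_R_iff)
    have iff: "card {w. col v w = i \<and> col w y = j} = 2 \<longleftrightarrow> (\<forall>x. col v x = i \<longrightarrow> col x y = j)" for y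
    proof
      assume "card {w. col v w = i \<and> col w y = j} = 2"
      then have "{w. col v w = i \<and> col w y = j} = {w. col v w = i}"
        using ci by (intro card_subset_eq) auto
      then show "\<forall>x. col v x = i \<longrightarrow> col x y = j" by blast
    next
      assume "\<forall>x. col v x = i \<longrightarrow> col x y = j"
      then have "{w. col v w = i \<and> col w y = j} = {w. col v w = i}" by blast
      then show "card {w. col v w = i \<and> col w y = j} = 2" using ci by simp
    qed
    have "intersection_number R i j k = 2 \<longleftrightarrow> (\<forall>x. col v x = i \<longrightarrow> col x y = j)"
      if "col v y = k" for y
      unfolding n[OF that] by (rule iff)
    then show ?thesis using y0 by blast
  qed
  then show ?thesis
    using True by (auto simp: diamond_pair_def suborbit_eq)
next
  case False
  then show ?thesis by (auto simp: diamond_pair_def suborbit_eq)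
qed

end

section \<open>The simultaneous swap\<close>

locale quasi_thin_scheme = scheme +
  fixes v :: 'a
  assumes quasi_thin: "quasi_thin d R"
begin

abbreviation stab :: "('a \<Rightarrow> 'a) set" where
  "stab \<equiv> point_stabilizer (scheme_Aut d R) v"

lemma ex_mate: "\<exists>y. {w. col v w = col v x} = {x, y}"
proof -
  have "card {w. col v w = col v x} \<in> {1, 2}"
    using quasi_thin valency_eq[OF assoc col_le, of v x v]
    by (metis col_le quasi_thin_def suborbit_eq)
  moreover have "\<exists>y. S = {x, y}" if "card S \<in> {1, 2}" "x \<in> S" for S
    using that by (auto simp: card_1_singleton_iff card_2_iff)
  ultimately show ?thesis by simp
qed

text \<open>This is the simultaneous swap; on a suborbit of size 1 the equation forces
  \<open>y = x\<close>, so the point is fixed.\<close>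

definition mate :: "'a \<Rightarrow> 'a" where
  "mate x = (SOME y. {w. col v w = col v x} = {x, y})"

lemma suborbit_mate: "{w. col v w = col v x} = {x, mate x}"
  unfolding mate_def by (rule someI_ex[OF ex_mate])

lemma same_suborbit_iff: "col v w = col v x \<longleftrightarrow> w = x \<or> w = mate x"
  using suborbit_mate[of x] by blast

lemma col_mate [simp]: "col v (mate x) = col v x"
  by (simp add: same_suborbit_iff)

lemma mate_mate [simp]: "mate (mate x) = x"
  using suborbit_mate[of x] suborbit_mate[of "mate x"] by (auto simp: doubleton_eq_iff)

lemma card_suborbit: "card {w. col v w = col v x} = 2 \<longleftrightarrow> mate x \<noteq> x"
  unfolding suborbit_mate by (auto simp: card_insert_if)

text \<open>In the two by two table of colours between \<open>{x, mate x}\<close> and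
  \<open>{y, mate y}\<close>, both columns contain the same colours by regularity, and so do both
  rows by passing to converses. If the corner \<open>(x, y)\<close> differed from the opposite one,
  both neighbours would share its colour, leaving no other colour for the opposite corner.\<close>

lemma col_mate_mate: "col (mate x) (mate y) = col x y"
proof -
  have L: "col w (mate z) = col w z \<or> col (mate w) (mate z) = col w z" for w z
    using col_transfer[of v z "mate z" w] unfolding same_suborbit_iff by auto
  have L': "col (mate w) z = col w z \<or> col (mate w) (mate z) = col w z" for w z
    using L[of z w] col_converse[of z "mate w" z w] col_converse[of "mate z" "mate w" z w] by blast
  show ?thesis
    using L[of x y] L[of "mate x" y] L[of "mate x" "mate y"] L'[of x y] L'[of x "mate y"]
    unfolding mate_mate by argo
qed

lemma mate_stab: "mate \<in> stab"
proof -
  have "bij mate" by (rule involuntory_imp_bij) simp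
  moreover have "mate v = v" using col_mate[of v] by (simp only: col_self_iff)
  ultimately show ?thesis
    by (simp add: point_stabilizer_def scheme_Aut_iff col_mate_mate)
qed

text \<open>The stabilizer preserves suborbits, so each element fixes or swaps the points of each of
  them; by injectivity it commutes with \<open>mate\<close>.\<close>

lemma stab_image:
  assumes "g \<in> stab"
  shows "g x = x \<or> g x = mate x" "g (mate x) = mate (g x)"
proof -
  show *: "g x = x \<or> g x = mate x" for x
    using stabilizer_col(4)[OF assms] by (simp add: same_suborbit_iff)
  have "g (mate x) = g x \<longleftrightarrow> mate x = x"
    using stabilizer_col(1)[OF assms] by (simp add: bij_is_inj inj_eq)
  then show "g (mate x) = mate (g x)"
    using *[of x] *[of "mate x"] by auto
qed

section \<open>Diamond pairs and invariant matrices\<close>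

text \<open>Only the identity and \<open>mate\<close> remain after restriction, and \<open>x\<close>
  tells them apart. The contrapositive is what gets applied: a group other than \<open>Z2\<close>
  has an element acting differently on the two suborbits.\<close>

lemma induced_group_Z2:
  assumes xS: "x \<in> S" "mate x \<noteq> x" and S: "mate ` S \<subseteq> S"
    and two: "\<And>g. g \<in> stab \<Longrightarrow> (\<forall>z\<in>S. g z = z) \<or> (\<forall>z\<in>S. g z = mate z)"
  shows "induced_group stab S \<cong> integer_mod_group 2"
proof -
  let ?e = "restrict id S" and ?m = "restrict mate S"
  have neq: "?m \<noteq> ?e"
    using xS by (metis id_apply restrict_apply)
  have "id \<in> stab" by (simp add: point_stabilizer_def scheme_Aut_iff)
  then have C: "(\<lambda>g. restrict g S) ` stab = {?e, ?m}"
  proof (intro equalityI subsetI)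
    fix f assume "f \<in> (\<lambda>g. restrict g S) ` stab"
    then obtain g where "g \<in> stab" "f = restrict g S" by blast
    with two[of g] show "f \<in> {?e, ?m}" by (auto simp: fun_eq_iff restrict_def)
  qed (use mate_stab in auto)
  have B: "f \<in> Bij S" if "f \<in> {?e, ?m}" for f
  proof -
    have "bij_betw mate S S"
      by (rule bij_betw_byWitness[of _ mate]) (use S in auto)
    then show ?thesis using that by (auto simp: Bij_def)
  qed
  have c: "f \<otimes>\<^bsub>induced_group stab S\<^esub> g = compose S f g" if "f \<in> {?e, ?m}" "g \<in> {?e, ?m}" for f g
    using B[OF that(1)] B[OF that(2)] by (simp add: induced_group_def BijGroup_def)
  have comp: "compose S ?e ?e = ?e" "compose S ?e ?m = ?m" "compose S ?m ?e = ?m" "compose S ?m ?m = ?e"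
    using S by (auto simp: compose_def restrict_def fun_eq_iff)
  let ?h = "\<lambda>f. if f = ?e then 0 else 1::int"
  have "?h \<in> iso (induced_group stab S) (integer_mod_group 2)"
  proof (rule isoI)
    have car: "carrier (induced_group stab S) = {?e, ?m}"
      unfolding induced_group_def using C by simp
    have car': "carrier (integer_mod_group 2) = {0, 1}"
      by (auto simp: carrier_integer_mod_group)
    show "?h \<in> hom (induced_group stab S) (integer_mod_group 2)"
      unfolding hom_def car car'
      using neq by (auto simp: c comp mult_integer_mod_group)
    show "bij_betw ?h (carrier (induced_group stab S)) (carrier (integer_mod_group 2))"
      unfolding car car' using neq by (auto simp: bij_betw_def)
  qed
  then show ?thesis by (auto simp: is_iso_def)
qed

text \<open>Some \<open>g\<close> in the stabilizer swaps exactly one of the two suborbits. Together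
  with \<open>mate\<close> it makes the stabilizer transitive on the block, so \<open>M\<close> is
  constant there.\<close>

lemma diamond_invariant:
  assumes no: "\<not> Z2_diamond_pair d R v (col v x) (col v y)"
    and D: "diamond_pair d R v (col v x) (col v y)"
    and inv: "\<And>g x y. g \<in> stab \<Longrightarrow> M $ g x $ g y = M $ x $ y"
  shows "M $ mate x $ y = M $ x $ y"
proof -
  let ?S = "suborbit R v (col v x) \<union> suborbit R v (col v y)"
  have S: "?S = {x, mate x, y, mate y}"
    unfolding suborbit_eq[OF col_le] suborbit_mate by auto
  have "mate x \<noteq> x"
    using D unfolding diamond_pair_iff card_suborbit by blast
  moreover have "\<not> induced_group stab ?S \<cong> integer_mod_group 2"
    using no D by (simp add: Z2_diamond_pair_def)
  moreover have "x \<in> ?S" "mate ` ?S \<subseteq> ?S"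
    unfolding S by auto
  ultimately obtain g where g: "g \<in> stab" "\<exists>z\<in>?S. g z \<noteq> z" "\<exists>z\<in>?S. g z \<noteq> mate z"
    using induced_group_Z2[of x ?S] by blast
  \<comment> \<open>As \<open>g\<close> commutes with \<open>mate\<close>, its values at
    \<open>x\<close> and \<open>y\<close> determine it on \<open>?S\<close>.\<close>
  have mixed: "g x = x \<and> g y = mate y \<or> g x = mate x \<and> g y = y"
  proof -
    have "\<not> (g x = x \<and> g y = y)"
      using g(2) stab_image(2)[OF g(1)] unfolding S by auto
    moreover have "\<not> (g x = mate x \<and> g y = mate y)"
      using g(3) stab_image(2)[OF g(1)] unfolding S by auto
    ultimately show ?thesis
      using stab_image(1)[OF g(1), of x] stab_image(1)[OF g(1), of y] by blast
  qed
  then show ?thesis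
  proof
    assume "g x = x \<and> g y = mate y"
    then have "M $ x $ mate y = M $ x $ y" using inv[OF g(1), of x y] by simp
    then show ?thesis using inv[OF mate_stab, of x "mate y"] by simp
  next
    assume "g x = mate x \<and> g y = y"
    then show ?thesis using inv[OF g(1), of x y] by simp
  qed
qed

text \<open>A class of pairs with equal colour triple has at most four members. Moving both
  coordinates is achieved by \<open>mate\<close>; moving only one within the class forces a diamond
  pair, unless a suborbit is a singleton.\<close>

lemma centralizer_subset_T0_space:
  assumes no: "\<And>i k. \<not> Z2_diamond_pair d R v i k"
  shows "centralizer_algebra stab \<subseteq> T0_space d R v"
proof
  fix M assume "M \<in> centralizer_algebra stab"
  then have inv: "M $ g x $ g y = M $ x $ y" if "g \<in> stab" for g x y
    using that by (simp add: stabilizer_centralizer_iff)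
  have swap: "M $ mate x $ y = M $ x $ y" if c: "col (mate x) y = col x y" for x y
  proof (cases "mate x = x \<or> mate y = y")
    case True
    then show ?thesis using inv[OF mate_stab, of x y] by auto
  next
    case False
    \<comment> \<open>Opposite corners of the table agree in any case, so one pair of equal
      neighbours makes all four colours equal.\<close>
    have "\<forall>x'\<in>{x, mate x}. \<forall>y'\<in>{y, mate y}. col x' y' = col x y"
      using c col_mate_mate[of x y] col_mate_mate[of x "mate y"] by simp
    then have "\<forall>x' y'. col v x' = col v x \<and> col v y' = col v y \<longrightarrow> col x' y' = col x y"
      by (auto simp: same_suborbit_iff)
    then have "diamond_pair d R v (col v x) (col v y)"
      unfolding diamond_pair_iff using False card_suborbit col_le by blast
    then show ?thesis using diamond_invariant[OF no _ inv] by blast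
  qed
  show "M \<in> T0_space d R v"
    unfolding T0_space_iff
  proof (intro allI impI, elim conjE)
    fix x y x' y'
    assume *: "col v x' = col v x" "col x' y' = col x y" "col v y' = col v y"
    then consider "x' = x" "y' = y" | "x' = mate x" "y' = mate y" | "x' = mate x" "y' = y"
      | "x' = x" "y' = mate y"
      by (auto simp: same_suborbit_iff)
    then show "M $ x' $ y' = M $ x $ y"
    proof cases
      \<comment> \<open>\<open>mate\<close> sends \<open>(x, mate y)\<close> to
        \<open>(mate x, y)\<close>, which reduces this case to \<open>swap\<close>.\<close>
      case 4
      then have "col (mate x) y = col x y"
        using *(2) col_mate_mate[of x "mate y"] by simp
      then show ?thesis
        using swap[of x y] inv[OF mate_stab, of x "mate y"] 4 by simp
    qed (use * swap inv[OF mate_stab] in auto)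
  qed
qed

text \<open>An invariant matrix that must be constant on the block yields an element fixing
  \<open>x\<close> and moving \<open>y\<close>. With the identity and \<open>mate\<close> this gives
  three elements in a group of order 2.\<close>

lemma not_Z2_diamond_pair:
  assumes sub: "centralizer_algebra stab \<subseteq> T0_space d R v"
  shows "\<not> Z2_diamond_pair d R v i k"
proof
  assume Z: "Z2_diamond_pair d R v i k"
  let ?S = "suborbit R v i \<union> suborbit R v k"
  from Z have D: "diamond_pair d R v i k"
    and I: "induced_group stab ?S \<cong> integer_mod_group 2"
    by (auto simp: Z2_diamond_pair_def)
  have "card {w. col v w = i} = 2" "card {w. col v w = k} = 2"
    using D unfolding diamond_pair_iff by simp_all
  then have "{w. col v w = i} \<noteq> {}" "{w. col v w = k} \<noteq> {}"
    by force+
  then obtain x y where xy: "i = col v x" "k = col v y"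
    by blast
  have m: "mate x \<noteq> x" "mate y \<noteq> y"
    using D unfolding xy diamond_pair_iff card_suborbit by blast+
  have id: "id \<in> stab" by (simp add: point_stabilizer_def scheme_Aut_iff)
  have comp: "g \<circ> h \<in> stab" if "g \<in> stab" "h \<in> stab" for g h
    using that by (auto simp: point_stabilizer_def scheme_Aut_iff intro: bij_comp)
  \<comment> \<open>The indicator of the orbit of \<open>(x, y)\<close> is invariant; lying in \<open>T\<^sub>0\<close>, it is constant on
    \<open>\<Delta>\<^sub>i \<times> \<Delta>\<^sub>k\<close>.\<close>
  define M :: "complex^'a^'a" where
    "M = (\<chi> a b. if \<exists>g\<in>stab. a = g x \<and> b = g y then 1 else 0)"
  have "M \<in> centralizer_algebra stab"
    unfolding stabilizer_centralizer_iff
  proof (intro ballI allI)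
    fix g a b assume g: "g \<in> stab"
    \<comment> \<open>Every element of the stabilizer is an involution or the identity, so
      \<open>g\<close> serves as its own inverse.\<close>
    have inv: "g (g z) = z" for z
      using stab_image(1)[OF g, of z] stab_image(2)[OF g, of z] by auto
    have "(\<exists>h\<in>stab. g a = h x \<and> g b = h y) \<longleftrightarrow> (\<exists>h\<in>stab. a = h x \<and> b = h y)"
    proof
      assume "\<exists>h\<in>stab. g a = h x \<and> g b = h y"
      then obtain h where h: "h \<in> stab" "g a = h x" "g b = h y" by blast
      then have "a = (g \<circ> h) x" "b = (g \<circ> h) y"
        using inv[of a] inv[of b] by simp_all
      then show "\<exists>h\<in>stab. a = h x \<and> b = h y"
        using comp[OF g h(1)] by blast
    next
      assume "\<exists>h\<in>stab. a = h x \<and> b = h y"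
      then obtain h where h: "h \<in> stab" "a = h x" "b = h y" by blast
      then have "g a = (g \<circ> h) x" "g b = (g \<circ> h) y"
        by simp_all
      then show "\<exists>h\<in>stab. g a = h x \<and> g b = h y"
        using comp[OF g h(1)] by blast
    qed
    then show "M $ g a $ g b = M $ a $ b" by (simp add: M_def)
  qed
  then have "M \<in> T0_space d R v"
    using sub by (rule rev_subsetD)
  note const = this[unfolded T0_space_iff, rule_format]
  obtain j where j: "\<And>x' y'. col v x' = col v x \<Longrightarrow> col v y' = col v y \<Longrightarrow> col x' y' = j"
    using D unfolding xy diamond_pair_iff by blast
  have "col x (mate y) = col x y"
    using j[of x y] j[of x "mate y"] by simp
  then have "M $ x $ mate y = M $ x $ y"
    by (intro const) simp
  also have "\<dots> = 1"
  proof -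
    have "\<exists>g\<in>stab. x = g x \<and> y = g y"
      using id by (intro bexI[of _ id]) simp_all
    then show ?thesis by (simp add: M_def)
  qed
  finally have "\<exists>g\<in>stab. x = g x \<and> mate y = g y"
    by (simp add: M_def split: if_splits)
  then obtain g where "g \<in> stab" "x = g x" "mate y = g y"
    by blast
  then have g: "g \<in> stab" "g x = x" "g y = mate y"
    by simp_all
  let ?r = "\<lambda>g. restrict g ?S"
  have S: "x \<in> ?S" "y \<in> ?S"
    unfolding xy using col_in by blast+
  \<comment> \<open>The points \<open>x\<close> and \<open>y\<close> suffice to separate the three
    restrictions.\<close>
  have "?r id x \<noteq> ?r mate x" "?r g x \<noteq> ?r mate x" "?r g y \<noteq> ?r id y"
    unfolding restrict_apply' [OF S(1)] restrict_apply' [OF S(2)] using m g(2,3) by simp_all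
  then have "?r id \<noteq> ?r mate" "?r g \<noteq> ?r mate" "?r g \<noteq> ?r id"
    by metis+
  then have "card {?r id, ?r mate, ?r g} = 3" by simp
  moreover have "{?r id, ?r mate, ?r g} \<subseteq> carrier (induced_group stab ?S)"
    using id mate_stab g(1) unfolding induced_group_def by simp
  moreover have "card (carrier (induced_group stab ?S)) = 2"
    using iso_same_card[OF I] by (simp add: carrier_integer_mod_group)
  moreover from this have "finite (carrier (induced_group stab ?S))"
    by (simp add: card_ge_0_finite)
  ultimately show False
    using card_mono[of "carrier (induced_group stab ?S)" "{?r id, ?r mate, ?r g}"] by linarith
qed

end

theorem theorem1p2:
  fixes d :: nat and R :: "nat \<Rightarrow> ('a::finite) rel" and v :: 'a
  assumes "assoc_scheme d R"
    and "quasi_thin d R"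
    and "\<not> thin d R"
    and "transitive_on_points (scheme_Aut d R)"
  shows "triply_transitive d R v \<longleftrightarrow> \<not> (\<exists>i k. Z2_diamond_pair d R v i k)"
proof -
  interpret quasi_thin_scheme d R v
    using assms by unfold_locales
  show ?thesis
    using triply_transitive_iff assms(4) centralizer_subset_T0_space not_Z2_diamond_pair by blast
qed

end
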